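(* Let $\mathscr{B}\subset\mathbb{N}$ be an Erdős set, and let $(X_\eta,S)$ be the corresponding $\mathscr{B}$-free subshift. Then: (1) $(X_\eta,S)$ satisfies the Garden of Eden theorem, i.e., a cellular automaton $\tau:X_\eta\to X_\eta$ is surjective if and only if it is pre-injective. (2) If a cellular automaton $\tau:X_\eta\to X_\eta$ is surjective, then $\tau=S^t$ for some $t\in\mathbb{Z}$. (3) Every cellular automaton is given by a monotone code modulo a power of the shift: for every cellular automaton $\tau:X_\eta\to X_\eta$ there is $t\in\mathbb{Z}$ such that $\tau\circ S^t$ is given by a monotone code.
   Context: A set $\mathscr{B}\subset\mathbb{N}=\{1,2,\dots\}$ is primitive if no element of $\mathscr{B}$ divides another element of $\mathscr{B}$; all sets $\mathscr{B}$ are assumed primitive and $\mathscr{B}\neq\{1\}$. $\mathscr{B}$ is Erdős if it is infinite, its elements are pairwise coprime, and $\sum_{b\in\mathscr{B}}1/b<\infty$. Put $\mathcal{F}_{\mathscr{B}}=\mathbb{Z}\setminus\bigcup_{b\in\mathscr{B}}b\mathbb{Z}$ and let $\eta\in\{0,1\}^{\mathbb{Z}}$ be its characteristic function. Let $S$ be the left shift on $\{0,1\}^{\mathbb{Z}}$ (product topology), $(Sx)(j)=x(j+1)$. The $\mathscr{B}$-free subshift is $(X_\eta,S)$ with $X_\eta=\overline{\{S^r\eta: r\in\mathbb{Z}\}}$. A cellular automaton (CA) on a subshift $(X,S)$ is a continuous map $\tau:X\to X$ commuting with $S$. It is given by a code $\phi:\{0,1\}^{\{-\ell,\dots,\ell\}}\to\{0,1\}$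 ($\ell\ge 0$) if $\tau(x)(n)=\phi(x(n-\ell,n+\ell))$ for all $x\in X$, $n\in\mathbb{Z}$, where $x(n-\ell,n+\ell)$ is the block of $x$ on positions $n-\ell,\dots,n+\ell$, re-indexed by $\{-\ell,\dots,\ell\}$; only blocks that appear in some $x\in X$ are considered. A code $\phi$ is monotone if $\phi(B)\le B(0)$ for each block $B$ considered. A CA $\tau$ on $X$ is pre-injective if for any $x,y\in X$, $\tau(x)=\tau(y)$ implies that either $x=y$ or $x$ and $y$ differ at infinitely many coordinates. *)

theory Defs
  imports "HOL-Analysis.Analysis"
begin

definition primitive :: "nat set \<Rightarrow> bool" where
  "primitive B \<longleftrightarrow> (\<forall>a\<in>B. \<forall>b\<in>B. a dvd b \<longrightarrow> a = b)"

text \<open>The first three conjuncts are the standing assumptions made on every set \<open>B\<close>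
  (positive elements, primitive, not the singleton of 1).\<close>

definition Erdos_set :: "nat set \<Rightarrow> bool" where
  "Erdos_set B \<longleftrightarrow>
     0 \<notin> B \<and> primitive B \<and> B \<noteq> {1} \<and>
     infinite B \<and> pairwise coprime B \<and> (\<lambda>b. 1 / real b) summable_on B"

definition B_free :: "nat set \<Rightarrow> int set" where
  "B_free B = UNIV - (\<Union>b\<in>B. {n. int b dvd n})"

text \<open>The alphabet \<open>{0,1}\<close> is \<^typ>\<open>bool\<close> with \<^term>\<open>False\<close> for 0 and \<^term>\<open>True\<close> for 1;
  its type class order is \<open>0 \<le> 1\<close> and its type class topology is the discrete one
  (see \<open>open_bool_set\<close> below), so that \<^typ>\<open>int \<Rightarrow> bool\<close> carries the
  product topology.\<close>

type_synonym config = "int \<Rightarrow> bool"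

lemma open_bool_set: "open (A :: bool set)"
  by (rule open_discrete)

definition eta :: "nat set \<Rightarrow> config" where
  "eta B = (\<lambda>n. n \<in> B_free B)"

definition shift :: "config \<Rightarrow> config" where
  "shift x = (\<lambda>j. x (j + 1))"

definition shift_pow :: "int \<Rightarrow> config \<Rightarrow> config" where
  "shift_pow t = (if 0 \<le> t then shift ^^ nat t else inv shift ^^ nat (- t))"

lemma inv_shift: "inv shift x = (\<lambda>j. x (j - 1))"
proof (rule inv_f_eq)
  show "inj shift"
  proof (rule injI, rule ext)
    fix x y :: config and j
    assume "shift x = shift y"
    then have "shift x (j - 1) = shift y (j - 1)" by simp
    then show "x j = y j" by (simp add: shift_def)
  qed
qed (simp add: shift_def)

lemma shift_pow_apply: "shift_pow t x j = x (j + t)"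
proof -
  have pos: "(shift ^^ n) x j = x (j + int n)" for n j
    by (induction n arbitrary: j) (simp_all add: shift_def algebra_simps)
  have neg: "(inv shift ^^ n) x j = x (j - int n)" for n j
    by (induction n arbitrary: j) (simp_all add: inv_shift algebra_simps)
  show ?thesis
    by (simp add: shift_pow_def pos neg)
qed

definition X_eta :: "nat set \<Rightarrow> config set" where
  "X_eta B = closure (range (\<lambda>r. shift_pow r (eta B)))"

text \<open>Maps \<open>X \<rightarrow> X\<close> are total functions on configurations of which only the values on
  \<open>X\<close> are ever used.\<close>

definition cellular_automaton :: "config set \<Rightarrow> (config \<Rightarrow> config) \<Rightarrow> bool" where
  "cellular_automaton X \<tau> \<longleftrightarrow>
     \<tau> \<in> X \<rightarrow> X \<and> continuous_on X \<tau> \<and> (\<forall>x\<in>X. \<tau> (shift x) = shift (\<tau> x))"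

definition pre_injective :: "config set \<Rightarrow> (config \<Rightarrow> config) \<Rightarrow> bool" where
  "pre_injective X \<tau> \<longleftrightarrow>
     (\<forall>x\<in>X. \<forall>y\<in>X. \<tau> x = \<tau> y \<longrightarrow> x = y \<or> infinite {n. x n \<noteq> y n})"

text \<open>A block on \<open>{-l,...,l}\<close> is a function on \<^typ>\<open>int\<close> that is \<^term>\<open>undefined\<close>
  off that interval, so equality of such functions is equality of blocks.\<close>

definition window :: "nat \<Rightarrow> config \<Rightarrow> int \<Rightarrow> (int \<Rightarrow> bool)" where
  "window l x n = restrict (\<lambda>i. x (n + i)) {- int l..int l}"

definition blocks :: "config set \<Rightarrow> nat \<Rightarrow> (int \<Rightarrow> bool) set" where
  "blocks X l = {window l x n | x n. x \<in> X}"

definition given_by_code ::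
  "config set \<Rightarrow> (config \<Rightarrow> config) \<Rightarrow> nat \<Rightarrow> ((int \<Rightarrow> bool) \<Rightarrow> bool) \<Rightarrow> bool" where
  "given_by_code X \<tau> l \<phi> \<longleftrightarrow> (\<forall>x\<in>X. \<forall>n. \<tau> x n = \<phi> (window l x n))"

definition monotone_code :: "config set \<Rightarrow> nat \<Rightarrow> ((int \<Rightarrow> bool) \<Rightarrow> bool) \<Rightarrow> bool" where
  "monotone_code X l \<phi> \<longleftrightarrow> (\<forall>w\<in>blocks X l. \<phi> w \<le> w 0)"

end

theory Submission
  imports Defs "HOL-Number_Theory.Cong"
begin

text \<open>A sieve argument identifies \<open>X_\<eta>\<close> with the set of admissible configurations, those whose
  support misses a residue class modulo every \<open>b \<in> B\<close>. If \<open>\<tau>(x) \<le> S^t x\<close> failed for every \<open>t\<close>,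
  blocks witnessing the failures could be spread by the Chinese remainder theorem over all residue
  classes modulo one large \<open>b\<close>, producing an admissible \<open>x\<close> with \<open>\<tau>(x)\<close> not admissible. So \<open>\<tau>\<close>
  is decreasing up to a shift. A decreasing automaton that is onto fixes the maximal configuration
  \<open>\<eta>\<close> and therefore its dense orbit; a decreasing pre-injective automaton fixes every configuration
  of finite support, by induction on the size of the support, and these are dense. In both cases it is
  the identity.\<close>

section \<open>Chinese remainders and counting estimates for Erdos sets\<close>

lemma Erdos_setD:
  assumes "Erdos_set B"
  shows "infinite B" "pairwise coprime B" "(\<lambda>b. 1 / real b) summable_on B"
    and "\<And>b. b \<in> B \<Longrightarrow> 2 \<le> b"
proof -
  show "infinite B" "pairwise coprime B" "(\<lambda>b. 1 / real b) summable_on B"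
    using assms by (auto simp: Erdos_set_def)
  fix b assume b: "b \<in> B"
  have "b \<noteq> 1"
  proof
    assume "b = 1"
    \<comment> \<open>Since 1 divides every element, primitivity leaves no other element.\<close>
    with b assms have "B = {1}"
      by (auto simp: Erdos_set_def primitive_def)
    with assms show False by (simp add: Erdos_set_def)
  qed
  moreover have "b \<noteq> 0" using b assms by (auto simp: Erdos_set_def)
  ultimately show "2 \<le> b" by linarith
qed

lemma chinese_remainder_dvd:
  fixes u :: "nat \<Rightarrow> int"
  assumes "finite Q" "pairwise coprime Q" "0 \<notin> Q"
  obtains m where "\<And>b. b \<in> Q \<Longrightarrow> int b dvd m - u b"
proof -
  \<comment> \<open>The targets \<open>u b\<close> may be negative; reducing them modulo
    \<open>b\<close> turns them into natural numbers in the same classes.\<close>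
  have "\<exists>x. \<forall>b\<in>Q. [x = nat (u b mod int b)] (mod b)"
    by (rule chinese_remainder_nat) (use assms in \<open>auto simp: pairwise_def\<close>)
  then obtain x where x: "\<forall>b\<in>Q. [x = nat (u b mod int b)] (mod b)" ..
  have "int b dvd int x - u b" if "b \<in> Q" for b
  proof -
    have "b > 0" using that assms(3) by (metis gr0I)
    then have "int (nat (u b mod int b)) = u b mod int b" by simp
    moreover have "[int x = int (nat (u b mod int b))] (mod int b)"
      using x that by (simp only: cong_int_iff)
    ultimately have "[int x = u b] (mod int b)"
      by (simp add: cong_def)
    then show ?thesis by (simp add: cong_iff_dvd_diff)
  qed
  then show ?thesis by (rule that)
qed

text \<open>Some finite partial sum comes within \<open>\<epsilon>\<close> of the total; whatever
  lies outside it must fit into the remaining gap.\<close>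

lemma summable_on_tail_less:
  fixes f :: "'a \<Rightarrow> real"
  assumes "f summable_on B" "\<And>b. b \<in> B \<Longrightarrow> 0 \<le> f b" "0 < \<epsilon>"
  obtains F where "finite F" "F \<subseteq> B"
    "\<And>G. \<lbrakk>finite G; G \<subseteq> B - F\<rbrakk> \<Longrightarrow> sum f G < \<epsilon>"
proof -
  have "(sum f \<longlongrightarrow> infsum f B) (finite_subsets_at_top B)"
    using has_sum_infsum[OF assms(1)] by (simp add: has_sum_def)
  then have "\<forall>\<^sub>F F in finite_subsets_at_top B. infsum f B - \<epsilon> < sum f F"
    using assms(3) by (intro order_tendstoD) auto
  then obtain F where F: "finite F" "F \<subseteq> B" "infsum f B - \<epsilon> < sum f F"
    by (auto simp: eventually_finite_subsets_at_top)
  have "sum f G < \<epsilon>" if G: "finite G" "G \<subseteq> B - F" for G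
  proof -
    have "sum f F + sum f G = sum f (F \<union> G)"
      using F G by (intro sum.union_disjoint[symmetric]) auto
    also have "\<dots> \<le> infsum f B"
      by (rule finite_sum_le_infsum) (use F G assms in auto)
    finally show ?thesis using F(3) by linarith
  qed
  with F show ?thesis by (intro that) auto
qed

text \<open>Each \<open>b\<close> up to \<open>X\<close> satisfies \<open>1 \<le> X / b\<close>, so
  outside a finite set the count is at most \<open>X\<close> times a small tail of the series; the
  finite set goes into \<open>C\<close>. Thus \<open>B\<close> has density zero.\<close>

lemma card_le_of_summable_reciprocals:
  fixes B :: "nat set"
  assumes "(\<lambda>b. 1 / real b) summable_on B" "0 \<notin> B" "0 < \<epsilon>"
  obtains C where "0 \<le> C" "\<And>X. 0 \<le> X \<Longrightarrow> real (card {b \<in> B. real b \<le> X}) \<le> \<epsilon> * X + C"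
proof -
  obtain F where F: "finite F" "F \<subseteq> B"
    and tail: "\<And>G. \<lbrakk>finite G; G \<subseteq> B - F\<rbrakk> \<Longrightarrow> (\<Sum>b\<in>G. 1 / real b) < \<epsilon>"
    using summable_on_tail_less[OF assms(1) _ assms(3)] by auto
  have "real (card {b \<in> B. real b \<le> X}) \<le> \<epsilon> * X + real (card F)" if X: "0 \<le> X" for X
  proof -
    let ?G = "{b \<in> B - F. real b \<le> X}"
    have fin: "finite ?G"
      by (rule finite_subset[of _ "{..nat \<lfloor>X\<rfloor>}"]) (auto simp: le_nat_floor)
    have "real (card ?G) = (\<Sum>b\<in>?G. 1)" by simp
    also have "\<dots> \<le> (\<Sum>b\<in>?G. X * (1 / real b))"
    proof (rule sum_mono)
      fix b assume b: "b \<in> ?G"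
      then have "b \<noteq> 0" using assms(2) by (metis DiffD1 mem_Collect_eq)
      with b show "1 \<le> X * (1 / real b)" by (simp add: field_simps)
    qed
    also have "\<dots> = X * (\<Sum>b\<in>?G. 1 / real b)" by (simp add: sum_distrib_left)
    also have "\<dots> \<le> X * \<epsilon>"
      by (intro mult_left_mono less_imp_le[OF tail[OF fin]] X) auto
    finally have G: "real (card ?G) \<le> \<epsilon> * X" by (simp add: mult.commute)
    have "card {b \<in> B. real b \<le> X} \<le> card (?G \<union> F)"
      using fin F by (intro card_mono) auto
    also have "\<dots> \<le> card ?G + card F" by (rule card_Un_le)
    finally show ?thesis using G by linarith
  qed
  then show ?thesis by (intro that[of "real (card F)"]) auto
qed

text \<open>As \<open>M\<close> is invertible modulo \<open>b\<close>, the solutions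
  \<open>j\<close> share one residue class modulo \<open>b\<close> and are therefore determined by
  their quotients by \<open>b\<close>.\<close>

lemma card_dvd_progression:
  fixes b M c :: int
  assumes "0 < b" "coprime b M"
  shows "real (card {j \<in> {1..K::nat}. b dvd c + int j * M}) \<le> real K / real_of_int b + 1"
proof -
  let ?S = "{j \<in> {1..K}. b dvd c + int j * M}"
  have cong: "i mod nat b = j mod nat b" if "i \<in> ?S" "j \<in> ?S" for i j
  proof -
    have "b dvd (c + int i * M) - (c + int j * M)" using that by (intro dvd_diff) auto
    then have "b dvd (int i - int j) * M" by (simp add: algebra_simps)
    then have "b dvd int i - int j" using assms(2) by (simp add: coprime_dvd_mult_left_iff)
    then have "[int i = int j] (mod int (nat b))" using assms(1) by (simp add: cong_iff_dvd_diff)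
    then show ?thesis unfolding cong_int_iff by (simp add: cong_def)
  qed
  have "inj_on (\<lambda>j. j div nat b) ?S"
  proof (rule inj_onI)
    fix i j assume "i \<in> ?S" "j \<in> ?S" "i div nat b = j div nat b"
    then show "i = j"
      by (subst (1 2) div_mult_mod_eq[symmetric, of _ "nat b"]) (simp only: cong[of i j])
  qed
  then have "card ?S = card ((\<lambda>j. j div nat b) ` ?S)" by (simp add: card_image)
  also have "\<dots> \<le> card {..K div nat b}"
    by (intro card_mono) (auto intro: div_le_mono)
  also have "\<dots> = K div nat b + 1" by simp
  finally have "real (card ?S) \<le> real (K div nat b) + 1" by linarith
  also have "real (K div nat b) \<le> real K / real (nat b)" by (rule of_nat_div_le_of_nat)
  finally show ?thesis using assms(1) by simp
qed

section \<open>The sieve\<close>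

lemma mem_B_free: "n \<in> B_free B \<longleftrightarrow> (\<forall>b\<in>B. \<not> int b dvd n)"
  by (auto simp: B_free_def)

text \<open>Congruences modulo a finite \<open>Q\<close> give a progression
  \<open>n1 + j * M\<close> on which no element of \<open>Q\<close> divides any
  \<open>n + a\<close>. Every other \<open>b\<close> spoils at most \<open>K / b + 1\<close> of the
  \<open>j \<le> K\<close> for each \<open>a\<close>. The terms \<open>K / b\<close> are controlled
  by the tail of the reciprocal series, the terms 1 by the zero density of \<open>B\<close>, so for
  large \<open>K\<close> some \<open>j\<close> survives.\<close>

lemma B_free_translate_exists:
  fixes A :: "int set" and n0 :: int
  assumes B: "Erdos_set B" and A: "finite A" and P: "finite P" "P \<subseteq> B"
    and n0: "\<And>b a. \<lbrakk>b \<in> P; a \<in> A\<rbrakk> \<Longrightarrow> \<not> int b dvd n0 + a"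
    and adm: "\<And>b. b \<in> B \<Longrightarrow> \<exists>r. \<forall>a\<in>A. \<not> int b dvd a - r"
  obtains n where "\<And>b. b \<in> P \<Longrightarrow> int b dvd n - n0" "\<And>a. a \<in> A \<Longrightarrow> n + a \<in> B_free B"
proof -
  note B = Erdos_setD[OF B]
  have B0: "0 \<notin> B" using B(4) by force
  define k where "k = real (card A)"
  \<comment> \<open>Chosen so that \<open>k * \<epsilon>1 \<le> 1 / 2\<close>; the
    \<open>+ 1\<close> avoids a zero denominator when \<open>A\<close> is empty.\<close>
  define \<epsilon>1 where "\<epsilon>1 = 1 / (2 * (k + 1))"
  have k: "0 \<le> k" by (simp add: k_def)
  have "0 < \<epsilon>1" using k by (simp add: \<epsilon>1_def)
  obtain F where F: "finite F" "F \<subseteq> B"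
    and tail: "\<And>G. \<lbrakk>finite G; G \<subseteq> B - F\<rbrakk> \<Longrightarrow> (\<Sum>b\<in>G. 1 / real b) < \<epsilon>1"
    using summable_on_tail_less[OF B(3) _ \<open>0 < \<epsilon>1\<close>] by auto
  define Q where "Q = P \<union> F"
  have Q: "finite Q" "Q \<subseteq> B" "0 \<notin> Q" "pairwise coprime Q"
    using P F B0 B(2) by (auto simp: Q_def intro: pairwise_mono)
  obtain r where r: "\<And>b a. \<lbrakk>b \<in> B; a \<in> A\<rbrakk> \<Longrightarrow> \<not> int b dvd a - r b"
    using adm by metis
  \<comment> \<open>On \<open>P\<close> the class is prescribed by \<open>n0\<close>; elsewhere
    \<open>m + a\<close> is congruent to \<open>a - r b\<close>, which \<open>b\<close> does not
    divide.\<close>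
  obtain m where m: "\<And>b. b \<in> Q \<Longrightarrow> int b dvd m - (if b \<in> P then n0 else - r b)"
    using chinese_remainder_dvd[OF Q(1,4,3), of "\<lambda>b. if b \<in> P then n0 else - r b"] by blast
  define M where "M = int (\<Prod>Q)"
  have "0 < \<Prod>Q" using Q(3) by (intro prod_pos) (metis gr0I)
  then have M: "1 \<le> M" unfolding M_def by linarith
  have dvdM: "int b dvd M" if "b \<in> Q" for b
    using Q(1) that by (simp add: M_def dvd_prodI)
  have copM: "coprime (int b) M" if "b \<in> B - Q" for b
    using that Q B(2) by (auto simp: M_def pairwise_def intro!: prod_coprime_right) (metis subsetD)
  define S where "S = (\<Sum>a\<in>A. \<bar>a\<bar>)"
  have S: "\<bar>a\<bar> \<le> S" if "a \<in> A" for a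
    unfolding S_def by (rule member_le_sum) (use that A in auto)
  have S0: "0 \<le> S" by (simp add: S_def sum_nonneg)
  \<comment> \<open>Adding a multiple of \<open>M\<close> keeps all residues modulo \<open>Q\<close>
    and makes every \<open>n1 + a + j * M\<close> positive, so that a divisor of it is bounded by
    its size.\<close>
  define n1 where "n1 = m + (\<bar>m\<bar> + S + 1) * M"
  have "\<bar>m\<bar> + S + 1 \<le> (\<bar>m\<bar> + S + 1) * M"
    using M S0 mult_left_mono[of 1 M "\<bar>m\<bar> + S + 1"] by auto
  then have n1: "S + 1 \<le> n1" unfolding n1_def by linarith
  \<comment> \<open>Divisors range up to \<open>X = T + K * M\<close>; this choice bounds the part
    of their count that grows with \<open>K\<close> by \<open>K / 4\<close>, and \<open>D\<close>
    collects the part independent of \<open>K\<close>. In total fewer than \<open>K\<close> indices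
    are spoiled once \<open>K / 2 + K / 4 + D < K\<close>.\<close>
  define \<epsilon>2 where "\<epsilon>2 = 1 / (4 * (k + 1) * real_of_int M)"
  have "0 < \<epsilon>2" using k M by (simp add: \<epsilon>2_def)
  obtain C where C: "0 \<le> C" 
    "\<And>X. 0 \<le> X \<Longrightarrow> real (card {b \<in> B. real b \<le> X}) \<le> \<epsilon>2 * X + C"
    using card_le_of_summable_reciprocals[OF B(3) B0 \<open>0 < \<epsilon>2\<close>] by blast
  define T where "T = real_of_int (n1 + S)"
  have T: "0 \<le> T" using n1 S0 by (simp add: T_def)
  define D where "D = k * (\<epsilon>2 * T + C)"
  obtain K :: nat where K: "4 * D < real K" using reals_Archimedean2 by blast
  have Qfree: "\<not> int b dvd n1 + a + int j * M" if b: "b \<in> Q" and a: "a \<in> A" for a b j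
  proof
    assume d: "int b dvd n1 + a + int j * M"
    define u where "u = (if b \<in> P then n0 else - r b)"
    have "int b dvd (m - u) + (\<bar>m\<bar> + S + 1 + int j) * M"
      using m[OF b] dvdM[OF b] unfolding u_def by (intro dvd_add dvd_mult)
    with d have "int b dvd (n1 + a + int j * M) - ((m - u) + (\<bar>m\<bar> + S + 1 + int j) * M)"
      by (rule dvd_diff)
    then have "int b dvd u + a" by (simp add: n1_def algebra_simps)
    then show False
      using n0[of b a] r[of b a] a b Q(2) by (auto simp: u_def split: if_splits)
  qed
  define X where "X = T + real K * real_of_int M"
  define G where "G = {b \<in> B - Q. real b \<le> X}"
  have X: "0 \<le> X" using T M by (simp add: X_def)
  have finX: "finite {b \<in> B. real b \<le> X}"
    by (rule finite_subset[of _ "{..nat \<lfloor>X\<rfloor>}"]) (auto simp: le_nat_floor)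
  have G: "finite G" "G \<subseteq> B - F"
    by (rule finite_subset[OF _ finX]) (auto simp: G_def Q_def)
  have "\<exists>j\<in>{1..K}. \<forall>a\<in>A. n1 + a + int j * M \<in> B_free B"
  proof (rule ccontr)
    let ?N = "\<lambda>b a. {j \<in> {1..K}. int b dvd n1 + a + int j * M}"
    assume neg: "\<not> ?thesis"
    \<comment> \<open>A failing \<open>j\<close> is spoiled by some \<open>b\<close>, which is
      outside \<open>Q\<close> by the choice of the progression and at most \<open>X\<close> by
      positivity.\<close>
    have "{1..K} \<subseteq> (\<Union>b\<in>G. \<Union>a\<in>A. ?N b a)"
    proof
      fix j assume j: "j \<in> {1..K}"
      then obtain a b where ab: "a \<in> A" "b \<in> B" "int b dvd n1 + a + int j * M"
        using neg unfolding mem_B_free by blast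
      then have "b \<notin> Q" using Qfree by blast
      have "int j * M \<le> int K * M" using j M by (intro mult_right_mono) auto
      moreover have "0 \<le> int j * M" using M by simp
      moreover have "\<bar>a\<bar> \<le> S" by (rule S) fact
      ultimately have "0 < n1 + a + int j * M" "n1 + a + int j * M \<le> n1 + S + int K * M"
        using n1 by linarith+
      then have "int b \<le> n1 + S + int K * M"
        using zdvd_imp_le[OF ab(3)] by linarith
      then have "real_of_int (int b) \<le> real_of_int (n1 + S + int K * M)"
        by (simp only: of_int_le_iff)
      then have "real b \<le> X" by (simp add: X_def T_def)
      with \<open>b \<notin> Q\<close> ab j show "j \<in> (\<Union>b\<in>G. \<Union>a\<in>A. ?N b a)"
        by (auto simp: G_def)
    qed
    then have "card {1..K} \<le> card (\<Union>b\<in>G. \<Union>a\<in>A. ?N b a)"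
      using G A by (intro card_mono finite_UN_I) auto
    also have "\<dots> \<le> (\<Sum>b\<in>G. card (\<Union>a\<in>A. ?N b a))"
      by (rule card_UN_le) (rule G)
    also have "\<dots> \<le> (\<Sum>b\<in>G. \<Sum>a\<in>A. card (?N b a))"
      by (intro sum_mono card_UN_le A)
    finally have "real (card {1..K}) \<le> real (\<Sum>b\<in>G. \<Sum>a\<in>A. card (?N b a))"
      by (simp only: of_nat_le_iff)
    also have "\<dots> = (\<Sum>b\<in>G. \<Sum>a\<in>A. real (card (?N b a)))" by (simp only: of_nat_sum)
    also have "\<dots> \<le> (\<Sum>b\<in>G. \<Sum>a\<in>A. real K / real b + 1)"
    proof (intro sum_mono)
      fix b a assume b: "b \<in> G"
      then have "b \<in> B - Q" by (simp add: G_def)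
      then have "0 < int b" "coprime (int b) M" using copM B0 by (auto intro: gr0I)
      from card_dvd_progression[OF this, of K "n1 + a"]
      show "real (card (?N b a)) \<le> real K / real b + 1" by simp
    qed
    also have "\<dots> = k * (real K * (\<Sum>b\<in>G. 1 / real b) + real (card G))"
      by (simp add: k_def sum.distrib sum_distrib_left algebra_simps)
    also have "\<dots> \<le> k * (real K * \<epsilon>1 + (\<epsilon>2 * X + C))"
    proof (intro mult_left_mono add_mono k)
      show "(\<Sum>b\<in>G. 1 / real b) \<le> \<epsilon>1" using tail[OF G] by simp
      have "card G \<le> card {b \<in> B. real b \<le> X}"
        by (rule card_mono[OF finX]) (auto simp: G_def)
      then show "real (card G) \<le> \<epsilon>2 * X + C" using C(2)[OF X] by linarith
    qed auto
    also have "\<dots> = real K * (k * \<epsilon>1) + real K * (k * \<epsilon>2 * real_of_int M) + D"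
      by (simp add: X_def D_def algebra_simps)
    also have "\<dots> \<le> real K * (1 / 2) + real K * (1 / 4) + D"
    proof (intro add_mono mult_left_mono order_refl)
      show "k * \<epsilon>1 \<le> 1 / 2" using k by (simp add: \<epsilon>1_def field_simps)
      have "k * \<epsilon>2 * real_of_int M = k / (4 * (k + 1))" using M by (simp add: \<epsilon>2_def)
      also have "\<dots> \<le> 1 / 4" using k by (simp add: field_simps)
      finally show "k * \<epsilon>2 * real_of_int M \<le> 1 / 4" .
    qed auto
    finally show False using K by simp
  qed
  then obtain j where j: "\<And>a. a \<in> A \<Longrightarrow> n1 + a + int j * M \<in> B_free B" by blast
  show ?thesis
  proof (rule that[of "n1 + int j * M"])
    show "int b dvd n1 + int j * M - n0" if "b \<in> P" for b
    proof -
      have b: "b \<in> Q" using that by (simp add: Q_def)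
      have "int b dvd (m - n0) + (\<bar>m\<bar> + S + 1 + int j) * M"
        using m[OF b] dvdM[OF b] that by (intro dvd_add dvd_mult) (simp_all only: if_True)
      then show ?thesis by (simp add: n1_def algebra_simps)
    qed
    show "n1 + int j * M + a \<in> B_free B" if "a \<in> A" for a
      using j[OF that] by (simp add: algebra_simps)
  qed
qed

section \<open>Cylinders and compactness in the space of configurations\<close>

lemma open_contains_cylinder:
  fixes U :: "config set"
  assumes "open U" "x \<in> U"
  obtains l :: nat where "\<And>y. (\<And>i. \<bar>i\<bar> \<le> int l \<Longrightarrow> y i = x i) \<Longrightarrow> y \<in> U"
proof -
  have "openin (product_topology (\<lambda>i. euclidean) (UNIV :: int set)) U"
    using assms(1) by (simp add: open_fun_def)
  with assms(2) obtain V where V: "finite {i. V i \<noteq> UNIV}" "x \<in> Pi\<^sub>E UNIV V" "Pi\<^sub>E UNIV V \<subseteq> U"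
    by (auto simp: openin_product_topology_alt)
  \<comment> \<open>A basic open set constrains finitely many coordinates; the sum of their absolute
    values bounds them all.\<close>
  define l where "l = nat (\<Sum>i | V i \<noteq> UNIV. \<bar>i\<bar>)"
  have l: "\<bar>i\<bar> \<le> int l" if "V i \<noteq> UNIV" for i
  proof -
    have "\<bar>i\<bar> \<le> (\<Sum>i | V i \<noteq> UNIV. \<bar>i\<bar>)"
      by (rule member_le_sum) (use that V(1) in auto)
    then show ?thesis by (simp add: l_def)
  qed
  have "y \<in> U" if "\<And>i. \<bar>i\<bar> \<le> int l \<Longrightarrow> y i = x i" for y
  proof -
    have "y i \<in> V i" for i
      using V(2) that[OF l, of i] by (cases "V i = UNIV") (auto simp: PiE_UNIV_domain)
    then show ?thesis using V(3) by (auto simp: PiE_UNIV_domain)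
  qed
  then show ?thesis by (rule that)
qed

lemma clopen_coordinate:
  "open {x :: config. x i = v}" "closed {x :: config. x i = v}"
proof -
  have "open ((\<lambda>x :: config. x i) -` {v})" "closed ((\<lambda>x :: config. x i) -` {v})"
    by (auto intro!: open_vimage closed_vimage open_discrete finite_imp_closed)
  then show "open {x :: config. x i = v}" "closed {x :: config. x i = v}"
    by (simp_all add: vimage_def)
qed

lemma open_cylinder: "open {y :: config. \<forall>i\<in>{-int l..int l}. y i = x i}"
proof -
  have "{y :: config. \<forall>i\<in>{-int l..int l}. y i = x i} = (\<Inter>i\<in>{-int l..int l}. {y. y i = x i})"
    by auto
  also have "open \<dots>" by (intro open_INT ballI clopen_coordinate) auto
  finally show ?thesis .
qed

lemma in_closure_iff_cylinder:
  fixes x :: config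
  shows "x \<in> closure S \<longleftrightarrow> (\<forall>l::nat. \<exists>y\<in>S. \<forall>i\<in>{-int l..int l}. y i = x i)"
proof
  assume x: "x \<in> closure S"
  show "\<forall>l::nat. \<exists>y\<in>S. \<forall>i\<in>{-int l..int l}. y i = x i"
  proof
    fix l :: nat
    have "S \<inter> {y. \<forall>i\<in>{-int l..int l}. y i = x i} \<noteq> {}"
      using x open_cylinder[of l x] unfolding closure_iff_nhds_not_empty by blast
    then show "\<exists>y\<in>S. \<forall>i\<in>{-int l..int l}. y i = x i" by blast
  qed
next
  assume R: "\<forall>l::nat. \<exists>y\<in>S. \<forall>i\<in>{-int l..int l}. y i = x i"
  show "x \<in> closure S"
    unfolding closure_iff_nhds_not_empty
  proof (intro allI impI)
    fix A V assume "V \<subseteq> A" "open V" "x \<in> V"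
    obtain l :: nat where l: "\<And>y. (\<And>i. \<bar>i\<bar> \<le> int l \<Longrightarrow> y i = x i) \<Longrightarrow> y \<in> V"
      using open_contains_cylinder[OF \<open>open V\<close> \<open>x \<in> V\<close>] by blast
    obtain y where "y \<in> S" "\<forall>i\<in>{-int l..int l}. y i = x i" using R by blast
    moreover from this have "y \<in> V" by (intro l) (simp add: abs_le_iff)
    ultimately show "S \<inter> A \<noteq> {}" using \<open>V \<subseteq> A\<close> by blast
  qed
qed

text \<open>Tychonoff's theorem for the finite alphabet, then passage to a closed subset.\<close>

lemma compact_closed_config:
  fixes X :: "config set"
  assumes "closed X" shows "compact X"
proof -
  have "compact_space (product_topology (\<lambda>i. euclidean :: bool topology) (UNIV :: int set))"
    unfolding compact_space_product_topology
    by (simp add: compact_space_def compactin_euclidean_iff finite_imp_compact)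
  then have "compact (UNIV :: config set)"
    by (simp add: euclidean_product_topology compact_space_def compactin_euclidean_iff)
  then show ?thesis using assms compact_Int_closed by fastforce
qed

section \<open>Admissible configurations and the subshift\<close>

text \<open>The missed class \<open>r\<close> may depend on \<open>b\<close> and on \<open>x\<close>
  and need not be 0; this makes the condition invariant under shifts.\<close>

definition admissible :: "nat set \<Rightarrow> config \<Rightarrow> bool" where
  "admissible B x \<longleftrightarrow> (\<forall>b\<in>B. \<exists>r. \<forall>n. x n \<longrightarrow> \<not> int b dvd n - r)"

lemma admissible_mono: "admissible B x \<Longrightarrow> (\<And>n. y n \<Longrightarrow> x n) \<Longrightarrow> admissible B y"
  unfolding admissible_def by meson

lemma admissible_shift_pow:
  assumes "admissible B x" shows "admissible B (shift_pow t x)"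
  unfolding admissible_def shift_pow_apply
proof
  fix b assume "b \<in> B"
  then obtain r where "\<forall>n. x n \<longrightarrow> \<not> int b dvd n - r"
    using assms by (auto simp: admissible_def)
  then have "\<forall>n. x (n + t) \<longrightarrow> \<not> int b dvd n - (r - t)"
    by (auto simp: algebra_simps)
  then show "\<exists>r. \<forall>n. x (n + t) \<longrightarrow> \<not> int b dvd n - r" ..
qed

lemma admissible_eta: "admissible B (eta B)"
  unfolding admissible_def eta_def mem_B_free by (metis diff_zero)

text \<open>For positive \<open>b\<close> there are only finitely many classes to miss, so the
  existential quantifier over \<open>r\<close> becomes a finite union of closed sets.\<close>

lemma closed_admissible:
  assumes "0 \<notin> B" shows "closed {x. admissible B x}"
proof -
  have eq: "(\<exists>r. \<forall>n. x n \<longrightarrow> \<not> int b dvd n - r) \<longleftrightarrow>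
      (\<exists>r\<in>{0..<int b}. \<forall>n\<in>{n. int b dvd n - r}. x n = False)" (is "?L = ?R")
    if "b \<in> B" for b and x :: config
  proof
    assume ?L
    then obtain r where r: "\<forall>n. x n \<longrightarrow> \<not> int b dvd n - r" ..
    have "0 < int b" using assms that by (metis gr0I of_nat_0_less_iff)
    moreover have "int b dvd n - r" if "int b dvd n - r mod int b" for n
    proof -
      have "n - r = (n - r mod int b) - int b * (r div int b)"
        using mult_div_mod_eq[of "int b" r] by linarith
      then show ?thesis using that by (metis dvd_diff dvd_triv_left)
    qed
    ultimately show ?R using r by (intro bexI[of _ "r mod int b"]) auto
  qed auto
  have "{x. admissible B x} =
      (\<Inter>b\<in>B. \<Union>r\<in>{0..<int b}. \<Inter>n\<in>{n. int b dvd n - r}. {x. x n = False})"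
    by (auto simp: admissible_def eq)
  also have "closed \<dots>"
    by (intro closed_INT closed_UN ballI clopen_coordinate) simp
  finally show ?thesis .
qed

text \<open>The ones of the window come from the sieve. Each zero at \<open>i\<close> is forced by a
  private element \<open>g i\<close> of \<open>B\<close> dividing \<open>n + i\<close>; being longer
  than the window, \<open>g i\<close> divides no other \<open>n + a\<close> there.\<close>

lemma eta_window_exists:
  assumes B: "Erdos_set B" and x: "admissible B x"
  shows "\<exists>n. \<forall>i\<in>{-int l..int l}. shift_pow n (eta B) i = x i"
proof -
  note BD = Erdos_setD[OF B]
  let ?I = "{-int l..int l}"
  define A where "A = {i \<in> ?I. x i}"
  have A: "finite A" by (rule finite_subset[of _ ?I]) (auto simp: A_def)
  have "infinite (B - {..2 * l + 1})" using BD(1) by simp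
  then obtain f :: "nat \<Rightarrow> nat" where f: "inj f" "range f \<subseteq> B - {..2 * l + 1}"
    using infinite_countable_subset by blast
  define g where "g i = f (nat (i + int l))" for i
  have g: "g i \<in> B" "2 * l + 1 < g i" for i
    using subsetD[OF f(2) rangeI, of "nat (i + int l)"] by (auto simp: g_def)
  have "inj_on g ?I"
    by (auto simp: g_def inj_on_def dest!: injD[OF f(1)])
  define P where "P = g ` (?I - A)"
  have P: "finite P" "P \<subseteq> B" "pairwise coprime P" "0 \<notin> P"
    using g BD(2) by (auto simp: P_def intro: pairwise_mono) (metis not_less0)
  \<comment> \<open>The inverse of \<open>g\<close> recovers the position served by each modulus, so
    \<open>g i\<close> divides \<open>m + i\<close>.\<close>
  obtain m where m: "\<And>b. b \<in> P \<Longrightarrow> int b dvd m - (- inv_into ?I g b)"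
    using chinese_remainder_dvd[OF P(1,3,4), of "\<lambda>b. - inv_into ?I g b"] by blast
  have gm: "int (g i) dvd m + i" if "i \<in> ?I - A" for i
  proof -
    have "inv_into ?I g (g i) = i" by (rule inv_into_f_f[OF \<open>inj_on g ?I\<close>]) (use that in blast)
    moreover have "g i \<in> P" unfolding P_def using that by (rule imageI)
    ultimately show ?thesis using m[of "g i"] by simp
  qed
  have "\<not> int b dvd m + a" if b: "b \<in> P" and a: "a \<in> A" for b a
  proof
    assume d: "int b dvd m + a"
    obtain i where i: "i \<in> ?I - A" "b = g i" using b by (auto simp: P_def)
    have "int (g i) dvd (m + a) - (m + i)" using d gm[OF i(1)] i(2) by (intro dvd_diff) auto
    then have "int (g i) dvd a - i" by simp
    moreover have "a - i \<noteq> 0" using a i by auto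
    ultimately have "int (g i) \<le> \<bar>a - i\<bar>" by (metis dvd_imp_le_int abs_of_nat)
    moreover have "\<bar>a - i\<bar> \<le> 2 * int l" using a i by (auto simp: A_def)
    ultimately show False using g(2)[of i] by linarith
  qed
  moreover have "\<exists>r. \<forall>a\<in>A. \<not> int b dvd a - r" if "b \<in> B" for b
    using x that by (force simp: admissible_def A_def)
  ultimately obtain n where n: "\<And>b. b \<in> P \<Longrightarrow> int b dvd n - m" "\<And>a. a \<in> A \<Longrightarrow> n + a \<in> B_free B"
    using B_free_translate_exists[OF B A P(1,2)] by blast
  have "i + n \<notin> B_free B" if i: "i \<in> ?I - A" for i
  proof -
    have "int (g i) dvd (n - m) + (m + i)"
      by (rule dvd_add[OF n(1) gm[OF i]]) (use i in \<open>auto simp: P_def\<close>)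
    then show ?thesis using g(1)[of i] by (auto simp: mem_B_free add.commute)
  qed
  moreover have "i + n \<in> B_free B" if "i \<in> A" for i
    using n(2)[OF that] by (simp add: add.commute)
  ultimately have "\<forall>i\<in>?I. i + n \<in> B_free B \<longleftrightarrow> i \<in> A" by blast
  then have "\<forall>i\<in>?I. shift_pow n (eta B) i = x i"
    by (simp add: shift_pow_apply eta_def A_def)
  then show ?thesis ..
qed

lemma X_eta_eq_admissible:
  assumes "Erdos_set B" shows "X_eta B = {x. admissible B x}"
proof
  have "0 \<notin> B" using assms by (simp add: Erdos_set_def)
  then show "X_eta B \<subseteq> {x. admissible B x}"
    unfolding X_eta_def
    by (intro closure_minimal closed_admissible) (auto intro: admissible_shift_pow admissible_eta)
  show "{x. admissible B x} \<subseteq> X_eta B"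
    using eta_window_exists[OF assms] by (auto simp: X_eta_def in_closure_iff_cylinder)
qed

text \<open>An extra one of \<open>x\<close> at a multiple of \<open>b\<close> means that the class
  \<open>r\<close> missed by \<open>x\<close> is not 0 modulo \<open>b\<close>. The sieve then finds
  a B-free number in the class \<open>r\<close>, where \<open>x\<close> must be 1.\<close>

lemma eta_maximal:
  assumes B: "Erdos_set B" and x: "admissible B x" and le: "\<And>n. eta B n \<Longrightarrow> x n"
  shows "x = eta B"
proof (rule ext, rule ccontr)
  fix n assume "x n \<noteq> eta B n"
  then have n: "x n" "\<not> eta B n" using le by auto
  then obtain b where b: "b \<in> B" "int b dvd n" by (auto simp: eta_def mem_B_free)
  obtain r where r: "\<And>n. x n \<Longrightarrow> \<not> int b dvd n - r"
    using x b by (auto simp: admissible_def)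
  have "\<not> int b dvd r" using r[OF n(1)] b(2) by (auto intro: dvd_diff)
  moreover have "\<exists>r. \<not> int c dvd - r" if "c \<in> B" for c
    using Erdos_setD(4)[OF B that] by (intro exI[of _ 1]) auto
  ultimately obtain m where m: "int b dvd m - r" "m \<in> B_free B"
    using B_free_translate_exists[OF B, of "{0}" "{b}" r] b by auto
  then show False using r[of m] le[of m] by (simp add: eta_def)
qed

section \<open>Local rules and domination by a shift\<close>

lemma cellular_automaton_shift_pow:
  assumes X: "\<And>x t. x \<in> X \<Longrightarrow> shift_pow t x \<in> X"
    and \<tau>: "cellular_automaton X \<tau>" and x: "x \<in> X"
  shows "\<tau> (shift_pow t x) = shift_pow t (\<tau> x)"
proof -
  have pos: "\<tau> (shift_pow (int n) y) = shift_pow (int n) (\<tau> y)" if "y \<in> X" for n y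
  proof (induction n)
    case 0
    show ?case by (simp add: shift_pow_def)
  next
    case (Suc n)
    have "shift_pow (int (Suc n)) z = shift (shift_pow (int n) z)" for z
      by (rule ext) (simp add: shift_pow_apply shift_def algebra_simps)
    then show ?case
      using Suc \<tau> X[OF that, of "int n"] by (simp add: cellular_automaton_def)
  qed
  show ?thesis
  proof (cases "0 \<le> t")
    case True
    then show ?thesis using pos[OF x, of "nat t"] by simp
  next
    case False
    \<comment> \<open>A negative power is undone by a positive one, to which the case already proved
      applies.\<close>
    have "shift_pow (- t) (shift_pow t x) = x" by (rule ext) (simp add: shift_pow_apply)
    then have "\<tau> x = shift_pow (- t) (\<tau> (shift_pow t x))"
      using pos[OF X[OF x, of t], of "nat (- t)"] False by simp
    then show ?thesis by (simp add: fun_eq_iff shift_pow_apply)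
  qed
qed

text \<open>The locality half of the Curtis-Hedlund-Lyndon theorem: continuity of coordinate 0 gives
  a window depending on the point, compactness makes it uniform, and commutation with the shift
  carries it to every \<open>n\<close>.\<close>

lemma cellular_automaton_local:
  assumes X: "closed X" "\<And>x t. x \<in> X \<Longrightarrow> shift_pow t x \<in> X"
    and \<tau>: "cellular_automaton X \<tau>"
  obtains l :: nat where
    "\<And>x y n. \<lbrakk>x \<in> X; y \<in> X; \<And>i. \<bar>i\<bar> \<le> int l \<Longrightarrow> x (n + i) = y (n + i)\<rbrakk> \<Longrightarrow> \<tau> x n = \<tau> y n"
proof -
  have cont: "continuous_on X \<tau>"
    using \<tau> by (auto simp: cellular_automaton_def)
  have "\<exists>l::nat. \<forall>y\<in>X. (\<forall>i\<in>{-int l..int l}. y i = x i) \<longrightarrow> \<tau> y 0 = \<tau> x 0" if "x \<in> X" for x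
  proof -
    have "continuous_on X (\<lambda>y. \<tau> y 0)"
      by (rule continuous_on_product_then_coordinatewise[OF cont])
    then obtain A where A: "open A" "A \<inter> X = (\<lambda>y. \<tau> y 0) -` {\<tau> x 0} \<inter> X"
      unfolding continuous_on_open_invariant using open_discrete by meson
    then have "x \<in> A" using that by blast
    then obtain l :: nat where l: "\<And>y. (\<And>i. \<bar>i\<bar> \<le> int l \<Longrightarrow> y i = x i) \<Longrightarrow> y \<in> A"
      using open_contains_cylinder[OF A(1)] by blast
    have "\<tau> y 0 = \<tau> x 0" if "y \<in> X" "\<forall>i\<in>{-int l..int l}. y i = x i" for y
    proof -
      have "y \<in> A" using that(2) by (intro l) (simp add: abs_le_iff)
      then show ?thesis using A(2) that(1) by blast
    qed
    then show ?thesis by blast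
  qed
  then obtain L :: "config \<Rightarrow> nat" where L: "\<And>x y. \<lbrakk>x \<in> X; y \<in> X;
      \<forall>i\<in>{-int (L x)..int (L x)}. y i = x i\<rbrakk> \<Longrightarrow> \<tau> y 0 = \<tau> x 0"
    by metis
  define U where "U x = {y :: config. \<forall>i\<in>{-int (L x)..int (L x)}. y i = x i}" for x
  have "X \<subseteq> (\<Union>x\<in>X. U x)" by (auto simp: U_def)
  then obtain D where D: "D \<subseteq> X" "finite D" "X \<subseteq> (\<Union>x\<in>D. U x)"
    using compactE_image[OF compact_closed_config[OF X(1)], of X U] open_cylinder
    by (auto simp: U_def)
  \<comment> \<open>The sum dominates the radii of the finitely many cylinders of the cover.\<close>
  define l where "l = (\<Sum>x\<in>D. L x)"
  have at0: "\<tau> x 0 = \<tau> y 0" if x: "x \<in> X" and y: "y \<in> X" and eq: "\<And>i. \<bar>i\<bar> \<le> int l \<Longrightarrow> x i = y i" for x y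
  proof -
    obtain d where d: "d \<in> D" "x \<in> U d" using D(3) x by blast
    have "L d \<le> l" unfolding l_def by (rule member_le_sum) (use d D in auto)
    then have "x i = y i" if "i \<in> {-int (L d)..int (L d)}" for i
      using that by (intro eq) auto
    then have "y \<in> U d" using d(2) by (simp add: U_def)
    then show ?thesis using L[of d x] L[of d y] d x y D(1) by (auto simp: U_def)
  qed
  have shift0: "\<tau> (shift_pow n x) 0 = \<tau> x n" if "x \<in> X" for n x
    using cellular_automaton_shift_pow[OF X(2) \<tau> that] by (simp add: shift_pow_apply)
  show ?thesis
  proof (rule that)
    fix x y n assume "x \<in> X" "y \<in> X" and eq: "\<And>i. \<bar>i\<bar> \<le> int l \<Longrightarrow> x (n + i) = y (n + i)"
    then have "\<tau> (shift_pow n x) 0 = \<tau> (shift_pow n y) 0"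
      by (intro at0 X(2)) (auto simp: shift_pow_apply add.commute)
    then show "\<tau> x n = \<tau> y n" using \<open>x \<in> X\<close> \<open>y \<in> X\<close> by (simp add: shift0)
  qed
qed

text \<open>If no \<open>t\<close> works, then for each offset \<open>t\<close> in the window some block has image 1 and a 0 at
  \<open>t\<close>. Such a block may be centred at any point congruent to \<open>-t\<close> modulo \<open>b\<close> without
  meeting \<open>b\<int>\<close>, which is how every residue class modulo \<open>b\<close> becomes available as a centre.\<close>

lemma cellular_automaton_le_shift:
  assumes B: "Erdos_set B" and \<tau>: "cellular_automaton (X_eta B) \<tau>"
  obtains t where "\<And>x n. \<lbrakk>x \<in> X_eta B; \<tau> x n\<rbrakk> \<Longrightarrow> x (n + t)"
proof (rule ccontr)
  assume "\<not> thesis"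
  with that have neg: "\<And>t. \<exists>x n. x \<in> X_eta B \<and> \<tau> x n \<and> \<not> x (n + t)" by blast
  note BD = Erdos_setD[OF B]
  note X = X_eta_eq_admissible[OF B]
  have shX: "shift_pow t x \<in> X_eta B" if "x \<in> X_eta B" for x t
    using that by (simp add: X admissible_shift_pow)
  have hered: "y \<in> X_eta B" if "x \<in> X_eta B" "\<And>n. y n \<Longrightarrow> x n" for x y
    using that admissible_mono[of B x y] by (simp add: X)
  have sh: "\<tau> (shift_pow t x) n = \<tau> x (n + t)" if "x \<in> X_eta B" for x t n
    using cellular_automaton_shift_pow[OF shX \<tau> that] by (simp add: shift_pow_apply)
  have "closed (X_eta B)" by (simp add: X_eta_def)
  then obtain l :: nat where loc: "\<And>x y n. \<lbrakk>x \<in> X_eta B; y \<in> X_eta B;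
      \<And>i. \<bar>i\<bar> \<le> int l \<Longrightarrow> x (n + i) = y (n + i)\<rbrakk> \<Longrightarrow> \<tau> x n = \<tau> y n"
    using cellular_automaton_local[OF _ shX \<tau>] by blast
  have c: "\<exists>c\<in>X_eta B. \<tau> c 0 \<and> \<not> c t \<and> (\<forall>i. c i \<longrightarrow> \<bar>i\<bar> \<le> int l)" for t
  proof -
    obtain x n where x: "x \<in> X_eta B" "\<tau> x n" "\<not> x (n + t)" using neg by blast
    \<comment> \<open>Recentred at 0 and cut to the window: heredity keeps \<open>c\<close> in the
      subshift, and locality keeps the image at 0.\<close>
    define c where "c i \<longleftrightarrow> \<bar>i\<bar> \<le> int l \<and> shift_pow n x i" for i
    have "c \<in> X_eta B" by (rule hered[OF shX[OF x(1), of n]]) (simp add: c_def)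
    moreover from this have "\<tau> c 0 = \<tau> (shift_pow n x) 0"
      by (rule loc[OF _ shX[OF x(1)]]) (simp add: c_def)
    ultimately show ?thesis
      using x by (intro bexI[of _ c]) (auto simp: sh c_def shift_pow_apply add.commute)
  qed
  have "infinite (B - {..2 * l + 1})" using BD(1) by simp
  \<comment> \<open>As \<open>b\<close> exceeds the length of the window, at most one
    \<open>t\<close> in the window satisfies \<open>b dvd r + t\<close>.\<close>
  then obtain b where b: "b \<in> B" "2 * l + 1 < b" by (metis DiffD1 DiffD2 atMost_iff ex_in_conv
        finite.emptyI not_le)
  have "\<exists>d\<in>X_eta B. \<tau> d 0 \<and> (\<forall>i. d i \<longrightarrow> \<bar>i\<bar> \<le> int l \<and> \<not> int b dvd r + i)" for r
  proof (cases "\<exists>t. \<bar>t\<bar> \<le> int l \<and> int b dvd r + t")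
    case True
    then obtain t where t: "\<bar>t\<bar> \<le> int l" "int b dvd r + t" by blast
    obtain d where d: "d \<in> X_eta B" "\<tau> d 0" "\<not> d t" "\<And>i. d i \<Longrightarrow> \<bar>i\<bar> \<le> int l"
      using c[of t] by blast
    have "\<not> int b dvd r + i" if "d i" for i
    proof
      assume "int b dvd r + i"
      then have "int b dvd (r + i) - (r + t)" using t(2) by (rule dvd_diff)
      then have "int b dvd i - t" by simp
      moreover have "i - t \<noteq> 0" using that d(3) by auto
      ultimately have "int b \<le> \<bar>i - t\<bar>" by (metis dvd_imp_le_int abs_of_nat)
      then show False using d(4)[OF that] t(1) b(2) by linarith
    qed
    with d show ?thesis by blast
  next
    case False
    \<comment> \<open>No position of the window falls on a multiple of \<open>b\<close>, so any
      pattern with image 1 will do.\<close>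
    then show ?thesis using c[of 0] by blast
  qed
  then obtain d where d: "\<And>r. d r \<in> X_eta B" "\<And>r. \<tau> (d r) 0" "\<And>r i. d r i \<Longrightarrow> \<bar>i\<bar> \<le> int l"
    "\<And>r i. d r i \<Longrightarrow> \<not> int b dvd r + i"
    by metis
  \<comment> \<open>The bound is the number of positions available to \<open>b\<close> windows. A
    larger \<open>q\<close> misses a class of the configuration \<open>x\<close> assembled below by
    counting alone, so only \<open>Q\<close> needs congruences.\<close>
  define Q where "Q = {q \<in> B. q \<le> (2 * l + 1) * b}"
  have Q: "finite Q" "Q \<subseteq> B" "pairwise coprime Q" "0 \<notin> Q" "b \<in> Q"
    using BD(2) BD(4)[of 0] b(1) by (auto simp: Q_def intro: pairwise_mono)
  have "\<forall>r. \<forall>q\<in>B. \<exists>\<rho>. \<forall>i. d r i \<longrightarrow> \<not> int q dvd i - \<rho>"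
    using d(1) by (simp add: X admissible_def)
  then obtain \<rho> where "\<forall>r. \<forall>q\<in>B. \<forall>i. d r i \<longrightarrow> \<not> int q dvd i - \<rho> r q"
    unfolding bchoice_iff choice_iff by blast
  then have \<rho>: "\<And>r q i. \<lbrakk>q \<in> B; d r i\<rbrakk> \<Longrightarrow> \<not> int q dvd i - \<rho> r q" by blast
  \<comment> \<open>Centres for the patterns \<open>d r\<close>: class \<open>r\<close> modulo
    \<open>b\<close>, and modulo the other \<open>q\<close> a class that moves the one missed by
    \<open>d r\<close> to 0. All copies then miss the common class 0 for every element of
    \<open>Q\<close>.\<close>
  have "\<exists>m. \<forall>q\<in>Q. int q dvd m - (if q = b then r else - \<rho> r q)" for r
    by (rule chinese_remainder_dvd[OF Q(1,3,4), of "\<lambda>q. if q = b then r else - \<rho> r q"])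
      (rule exI, rule ballI)
  then obtain m :: "int \<Rightarrow> int" where m: "\<And>r q. q \<in> Q \<Longrightarrow> int q dvd m r - (if q = b then r else - \<rho> r q)"
    by metis
  define M where "M = int (\<Prod>Q)"
  have dvdM: "int q dvd M" if "q \<in> Q" for q
    using Q(1) that by (simp add: M_def dvd_prodI)
  have "0 < \<Prod>Q" using Q(4) by (intro prod_pos) (metis gr0I)
  then have M0: "0 < M" unfolding M_def by linarith
  then have M: "2 * int l < M" using zdvd_imp_le[OF dvdM[OF Q(5)]] b(2) by linarith
  \<comment> \<open>Multiples of \<open>M\<close> leave the residues modulo \<open>Q\<close>
    unchanged; the factor 2 separates distinct centres by more than \<open>M\<close>, hence by more
    than \<open>2 * l\<close>.\<close>
  define N where "N r = m r mod M + 2 * r * M" for r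
  have N: "int q dvd N r - (if q = b then r else - \<rho> r q)" if "q \<in> Q" for q r
  proof -
    have "N r - (if q = b then r else - \<rho> r q)
        = (m r - (if q = b then r else - \<rho> r q)) + M * (2 * r - m r div M)"
      using mult_div_mod_eq[of M "m r"] by (simp add: N_def algebra_simps)
    then show ?thesis using m[OF that] dvdM[OF that] by (metis dvd_add dvd_mult2)
  qed
  have far: "2 * int l < N s - N r" if "r < s" for r s
  proof -
    have "0 \<le> m s mod M" "m r mod M < M" using M0 by auto
    moreover have "2 * M * 1 \<le> 2 * M * (s - r)" using that M0 by (intro mult_left_mono) auto
    ultimately have "M < N s - N r" by (simp add: N_def algebra_simps)
    then show ?thesis using M by linarith
  qed
  define x where "x n \<longleftrightarrow> (\<exists>r\<in>{0..<int b}. d r (n - N r))" for n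
  have "admissible B x"
    unfolding admissible_def
  proof
    fix q assume q: "q \<in> B"
    show "\<exists>u. \<forall>n. x n \<longrightarrow> \<not> int q dvd n - u"
    proof (cases "q \<in> Q")
      case True
      have "\<not> int q dvd n" if xn: "x n" for n
      proof
        assume dn: "int q dvd n"
        obtain r where r: "d r (n - N r)" using xn by (auto simp: x_def)
        have "int q dvd n - (N r - (if q = b then r else - \<rho> r q))"
          using dn N[OF True] by (rule dvd_diff)
        then show False
          using d(4)[OF r] \<rho>[OF q r] by (auto simp: algebra_simps split: if_splits)
      qed
      then show ?thesis by (intro exI[of _ 0]) simp
    next
      case False
      let ?U = "\<Union>r\<in>{0..<int b}. {N r - int l..N r + int l}"
      have "finite ?U" by simp
      moreover have sub: "{n. x n} \<subseteq> ?U" by (auto simp: x_def abs_le_iff dest!: d(3))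
      ultimately have fin: "finite {n. x n}" by (rule finite_subset[rotated])
      \<comment> \<open>Pigeonhole: the support has fewer than \<open>q\<close> points and cannot
        meet all classes modulo \<open>q\<close>.\<close>
      have "card ((\<lambda>n. n mod int q) ` {n. x n}) \<le> card ((\<lambda>n. n mod int q) ` ?U)"
        using sub by (intro card_mono image_mono finite_imageI) simp_all
      also have "\<dots> \<le> card ?U" by (rule card_image_le) auto
      also have "\<dots> \<le> (\<Sum>r\<in>{0..<int b}. card {N r - int l..N r + int l})"
        by (rule card_UN_le) simp
      also have "\<dots> = (2 * l + 1) * b" by (simp add: nat_add_distrib nat_mult_distrib)
      also have "\<dots> < q" using False q by (auto simp: Q_def)
      also have "q = card {0..<int q}" by simp
      finally have "\<not> {0..<int q} \<subseteq> (\<lambda>n. n mod int q) ` {n. x n}"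
        using card_mono[OF finite_imageI[OF fin]] by (metis not_le)
      then obtain u where "u \<in> {0..<int q}" "u \<notin> (\<lambda>n. n mod int q) ` {n. x n}" by blast
      then have "\<not> int q dvd n - u" if "x n" for n
        using that by (auto simp: mod_eq_dvd_iff[symmetric] mod_pos_pos_trivial image_iff)
      then show ?thesis by blast
    qed
  qed
  then have xX: "x \<in> X_eta B" by (simp add: X)
  have hit: "\<tau> x (N r)" if r: "r \<in> {0..<int b}" for r
  proof -
    have "x (N r + i) = shift_pow (- N r) (d r) (N r + i)" if i: "\<bar>i\<bar> \<le> int l" for i
    proof
      assume "x (N r + i)"
      then obtain s where s: "d s (N r + i - N s)" by (auto simp: x_def)
      \<comment> \<open>By the separation of the centres, the window around \<open>N r\<close> sees
        no copy but its own.\<close>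
      have "s = r" using far[of s r] far[of r s] d(3)[OF s] i by (cases s r rule: linorder_cases) auto
      with s show "shift_pow (- N r) (d r) (N r + i)" by (simp add: shift_pow_apply)
    next
      assume "shift_pow (- N r) (d r) (N r + i)"
      then show "x (N r + i)" using r unfolding x_def
        by (intro bexI[of _ r]) (simp_all add: shift_pow_apply)
    qed
    then have "\<tau> x (N r) = \<tau> (shift_pow (- N r) (d r)) (N r)"
      by (intro loc[OF xX shX[OF d(1)]])
    then show ?thesis using d(2) by (simp add: sh[OF d(1)])
  qed
  have "admissible B (\<tau> x)" using \<tau> xX by (auto simp: cellular_automaton_def X)
  then obtain s where s: "\<And>n. \<tau> x n \<Longrightarrow> \<not> int b dvd n - s"
    using b(1) by (auto simp: admissible_def)
  \<comment> \<open>Every class modulo \<open>b\<close> contains a centre where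
    \<open>\<tau> x\<close> is 1, in particular the class \<open>s\<close> that
    \<open>\<tau> x\<close> was supposed to miss.\<close>
  define r where "r = s mod int b"
  have "int b dvd (N r - r) + (r - s)"
    using N[OF Q(5), of r] by (intro dvd_add) (auto simp: r_def mod_eq_dvd_iff[symmetric])
  moreover have "r \<in> {0..<int b}" using b(2) by (simp add: r_def)
  ultimately show False using s[OF hit[of r]] by simp
qed

section \<open>Rigidity of decreasing automata\<close>

text \<open>The value at \<open>n\<close> depends on a finite window, on which \<open>x\<close>
  coincides with a fixed point taken from \<open>D\<close>.\<close>

lemma cellular_automaton_eq_id_on_dense:
  assumes X: "closed X" "\<And>x t. x \<in> X \<Longrightarrow> shift_pow t x \<in> X"
    and \<sigma>: "cellular_automaton X \<sigma>"
    and D: "D \<subseteq> X" "X \<subseteq> closure D" "\<And>x. x \<in> D \<Longrightarrow> \<sigma> x = x"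
    and x: "x \<in> X"
  shows "\<sigma> x = x"
proof (rule ext)
  fix n
  obtain l :: nat where loc: "\<And>x y n. \<lbrakk>x \<in> X; y \<in> X;
      \<And>i. \<bar>i\<bar> \<le> int l \<Longrightarrow> x (n + i) = y (n + i)\<rbrakk> \<Longrightarrow> \<sigma> x n = \<sigma> y n"
    using cellular_automaton_local[OF X \<sigma>] by blast
  define k where "k = l + nat \<bar>n\<bar>"
  obtain y where y: "y \<in> D" "\<forall>i\<in>{-int k..int k}. y i = x i"
    using D(2) x unfolding in_closure_iff_cylinder subset_iff by blast
  have agree: "x (n + i) = y (n + i)" if "\<bar>i\<bar> \<le> int l" for i
  proof -
    have "n + i \<in> {-int k..int k}" using that by (auto simp: k_def)
    then show ?thesis using y(2) by simp
  qed
  have "\<sigma> x n = \<sigma> y n" using y(1) D(1) by (intro loc x agree) auto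
  also have "\<dots> = x n" using D(3)[OF y(1)] agree[of 0] by simp
  finally show "\<sigma> x n = x n" .
qed

text \<open>If \<open>\<sigma> x\<close> differed from \<open>x\<close>, its support would be
  strictly smaller, so \<open>\<sigma> x\<close> would be fixed by induction. Then \<open>x\<close>
  and \<open>\<sigma> x\<close> would have the same image while differing at finitely many
  places.\<close>

lemma decreasing_pre_injective_fixes_finite:
  assumes \<sigma>: "\<And>x. x \<in> X \<Longrightarrow> \<sigma> x \<in> X" "\<And>x n. \<lbrakk>x \<in> X; \<sigma> x n\<rbrakk> \<Longrightarrow> x n"
    and inj: "pre_injective X \<sigma>"
    and x: "x \<in> X" "finite {n. x n}"
  shows "\<sigma> x = x"
  using x
proof (induction "card {n. x n}" arbitrary: x rule: less_induct)
  case less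
  show ?case
  proof (rule ccontr)
    assume ne: "\<sigma> x \<noteq> x"
    have sub: "{n. \<sigma> x n} \<subset> {n. x n}"
      using \<sigma>(2)[OF less.prems(1)] ne by (auto simp: fun_eq_iff)
    then have "\<sigma> (\<sigma> x) = \<sigma> x"
      using less by (intro less.hyps \<sigma>(1) psubset_card_mono) (auto intro: finite_subset)
    moreover have "finite {n. \<sigma> x n \<noteq> x n}"
      by (rule finite_subset[OF _ less.prems(2)]) (use \<sigma>(2)[OF less.prems(1)] in auto)
    ultimately show False
      using inj ne less.prems(1) \<sigma>(1) unfolding pre_injective_def by blast
  qed
qed

text \<open>Admissibility passes to smaller supports, so truncating to a window stays inside the
  subshift.\<close>

lemma X_eta_subset_closure_finite:
  assumes "Erdos_set B"
  shows "X_eta B \<subseteq> closure {x \<in> X_eta B. finite {n. x n}}"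
proof
  fix x assume x: "x \<in> X_eta B"
  show "x \<in> closure {x \<in> X_eta B. finite {n. x n}}"
    unfolding in_closure_iff_cylinder
  proof
    fix l :: nat
    let ?y = "\<lambda>n. n \<in> {-int l..int l} \<and> x n"
    have "?y \<in> X_eta B"
      using x admissible_mono[of B x ?y] by (simp add: X_eta_eq_admissible[OF assms])
    moreover have "finite {n. ?y n}"
      by (rule finite_subset[of _ "{-int l..int l}"]) auto
    ultimately show "\<exists>y\<in>{x \<in> X_eta B. finite {n. x n}}. \<forall>i\<in>{-int l..int l}. y i = x i"
      by (intro bexI[of _ ?y]) auto
  qed
qed

lemma shift_pow_uminus: "shift_pow (- t) (shift_pow t x) = x"
  by (rule ext) (simp add: shift_pow_apply)

lemma continuous_on_shift_pow: "continuous_on S (shift_pow t)"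
proof (rule continuous_on_coordinatewise_then_product)
  fix i
  have "continuous_on S (\<lambda>x :: config. x (i + t))"
    by (rule continuous_on_subset[OF continuous_on_product_coordinates]) simp
  then show "continuous_on S (\<lambda>x. shift_pow t x i)" by (simp add: shift_pow_apply)
qed

lemma decreasing_automaton_eq_id:
  assumes B: "Erdos_set B" and \<sigma>: "cellular_automaton (X_eta B) \<sigma>"
    and le: "\<And>x n. \<lbrakk>x \<in> X_eta B; \<sigma> x n\<rbrakk> \<Longrightarrow> x n"
    and onto: "\<sigma> ` X_eta B = X_eta B \<or> pre_injective (X_eta B) \<sigma>"
    and x: "x \<in> X_eta B"
  shows "\<sigma> x = x"
proof -
  note X = X_eta_eq_admissible[OF B]
  have shX: "shift_pow t x \<in> X_eta B" if "x \<in> X_eta B" for x t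
    using that by (simp add: X admissible_shift_pow)
  have cl: "closed (X_eta B)" by (simp add: X_eta_def)
  have self: "\<sigma> x \<in> X_eta B" if "x \<in> X_eta B" for x
    using \<sigma> that by (auto simp: cellular_automaton_def)
  from onto show ?thesis
  proof
    assume surj: "\<sigma> ` X_eta B = X_eta B"
    have eta: "eta B \<in> X_eta B" by (simp add: X admissible_eta)
    then obtain z where z: "z \<in> X_eta B" "\<sigma> z = eta B" using surj by (metis imageE)
    \<comment> \<open>A decreasing map makes the preimage \<open>z\<close> lie above
      \<open>eta B\<close>, and maximality leaves only equality.\<close>
    have "z = eta B"
      using z le[OF z(1)] by (intro eta_maximal[OF B]) (simp_all add: X)
    with z have "\<sigma> (eta B) = eta B" by simp
    then have "\<sigma> y = y" if "y \<in> range (\<lambda>r. shift_pow r (eta B))" for y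
      using that cellular_automaton_shift_pow[OF shX \<sigma> eta] by auto
    then show ?thesis
      using shX[OF eta] by (intro cellular_automaton_eq_id_on_dense[OF cl shX \<sigma> _ _ _ x,
            of "range (\<lambda>r. shift_pow r (eta B))"]) (auto simp: X_eta_def)
  next
    assume "pre_injective (X_eta B) \<sigma>"
    then have "\<sigma> y = y" if "y \<in> X_eta B" "finite {n. y n}" for y
      using decreasing_pre_injective_fixes_finite[of "X_eta B" \<sigma> y] self le that by blast
    then show ?thesis
      by (intro cellular_automaton_eq_id_on_dense[OF cl shX \<sigma> _ X_eta_subset_closure_finite[OF B] _ x])
        auto
  qed
qed

section \<open>Codes and the assembly of the three claims\<close>

lemma cellular_automaton_compose_shift:
  assumes X: "\<And>x t. x \<in> X \<Longrightarrow> shift_pow t x \<in> X" and \<tau>: "cellular_automaton X \<tau>"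
  shows "cellular_automaton X (\<tau> \<circ> shift_pow t)"
  unfolding cellular_automaton_def
proof (intro conjI ballI)
  show "\<tau> \<circ> shift_pow t \<in> X \<rightarrow> X" using X \<tau> by (auto simp: cellular_automaton_def)
  show "continuous_on X (\<tau> \<circ> shift_pow t)"
    using \<tau> X by (intro continuous_on_compose continuous_on_shift_pow)
      (auto simp: cellular_automaton_def intro: continuous_on_subset)
  fix x assume "x \<in> X"
  moreover have "shift_pow t (shift x) = shift (shift_pow t x)"
    by (rule ext) (simp add: shift_pow_apply shift_def algebra_simps)
  ultimately show "(\<tau> \<circ> shift_pow t) (shift x) = shift ((\<tau> \<circ> shift_pow t) x)"
    using X \<tau> by (simp add: cellular_automaton_def)
qed

lemma given_by_code_exists:
  assumes X: "closed X" "\<And>x t. x \<in> X \<Longrightarrow> shift_pow t x \<in> X"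
    and \<tau>: "cellular_automaton X \<tau>"
  shows "\<exists>l \<phi>. given_by_code X \<tau> l \<phi>"
proof -
  obtain l :: nat where loc: "\<And>x y n. \<lbrakk>x \<in> X; y \<in> X;
      \<And>i. \<bar>i\<bar> \<le> int l \<Longrightarrow> x (n + i) = y (n + i)\<rbrakk> \<Longrightarrow> \<tau> x n = \<tau> y n"
    using cellular_automaton_local[OF X \<tau>] by blast
  \<comment> \<open>The image is read off any occurrence of the block; blocks that never occur get
    \<open>False\<close>.\<close>
  define \<phi> where "\<phi> w \<longleftrightarrow> (\<exists>x\<in>X. \<exists>n. w = window l x n \<and> \<tau> x n)" for w
  have "\<tau> x n = \<tau> y k" if "x \<in> X" "y \<in> X" "window l x n = window l y k" for x y n k
  proof -
    have "x (n + i) = y (k + i)" if "\<bar>i\<bar> \<le> int l" for i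
      using fun_cong[OF \<open>window l x n = window l y k\<close>, of i] that
      by (simp add: window_def abs_le_iff)
    \<comment> \<open>Shifting \<open>y\<close> by \<open>k - n\<close> aligns the two occurrences
      of the block, after which locality applies.\<close>
    then have "\<tau> x n = \<tau> (shift_pow (k - n) y) n"
      using that X(2) by (intro loc) (auto simp: shift_pow_apply algebra_simps)
    also have "\<dots> = \<tau> y k"
      using cellular_automaton_shift_pow[OF X(2) \<tau> that(2)] by (simp add: shift_pow_apply)
    finally show ?thesis .
  qed
  then have "given_by_code X \<tau> l \<phi>"
    unfolding given_by_code_def \<phi>_def by blast
  then show ?thesis by blast
qed

theorem theorem1p1:
  fixes B :: "nat set"
  assumes "Erdos_set B"
  shows "(\<forall>\<tau>. cellular_automaton (X_eta B) \<tau> \<longrightarrow>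
            (\<tau> ` X_eta B = X_eta B \<longleftrightarrow> pre_injective (X_eta B) \<tau>)) \<and>
         (\<forall>\<tau>. cellular_automaton (X_eta B) \<tau> \<longrightarrow> \<tau> ` X_eta B = X_eta B \<longrightarrow>
            (\<exists>t. \<forall>x\<in>X_eta B. \<tau> x = shift_pow t x)) \<and>
         (\<forall>\<tau>. cellular_automaton (X_eta B) \<tau> \<longrightarrow>
            (\<exists>t l \<phi>. given_by_code (X_eta B) (\<tau> \<circ> shift_pow t) l \<phi> \<and>
                     monotone_code (X_eta B) l \<phi>))"
proof -
  let ?X = "X_eta B"
  have shX: "shift_pow t x \<in> ?X" if "x \<in> ?X" for x t
    using that by (simp add: X_eta_eq_admissible[OF assms] admissible_shift_pow)
  have cl: "closed ?X" by (simp add: X_eta_def)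
  have image: "shift_pow t ` ?X = ?X" for t
  proof
    show "?X \<subseteq> shift_pow t ` ?X"
      using shX shift_pow_uminus[of "- t"] by (metis image_iff minus_minus subsetI)
  qed (use shX in blast)
  have inj: "shift_pow t x = shift_pow t y \<Longrightarrow> x = y" for t x y
    by (metis shift_pow_uminus)
  have decr: "\<exists>t. \<forall>x\<in>?X. \<forall>n. (\<tau> \<circ> shift_pow t) x n \<longrightarrow> x n"
    if \<tau>: "cellular_automaton ?X \<tau>" for \<tau>
  proof -
    obtain t where t: "\<And>x n. \<lbrakk>x \<in> ?X; \<tau> x n\<rbrakk> \<Longrightarrow> x (n + t)"
      using cellular_automaton_le_shift[OF assms \<tau>] by blast
    \<comment> \<open>The shift dominating \<open>\<tau>\<close> is cancelled by precomposing with
      its inverse, hence the sign change.\<close>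
    have "x n" if "x \<in> ?X" "(\<tau> \<circ> shift_pow (- t)) x n" for x n
      using t[OF shX[OF that(1)]] that(2) by (force simp: shift_pow_apply)
    then show ?thesis by blast
  qed
  \<comment> \<open>Surjectivity and pre-injectivity are treated together: either one forces a power
    of the shift, which has both properties, and this yields both directions of the
    equivalence.\<close>
  have shift: "\<exists>t. \<forall>x\<in>?X. \<tau> x = shift_pow t x"
    if \<tau>: "cellular_automaton ?X \<tau>" and or: "\<tau> ` ?X = ?X \<or> pre_injective ?X \<tau>" for \<tau>
  proof -
    obtain t where t: "\<forall>x\<in>?X. \<forall>n. (\<tau> \<circ> shift_pow t) x n \<longrightarrow> x n" using decr[OF \<tau>] by blast
    have "(\<tau> \<circ> shift_pow t) ` ?X = ?X \<or> pre_injective ?X (\<tau> \<circ> shift_pow t)"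
      using or
    proof
      assume "\<tau> ` ?X = ?X"
      then show ?thesis using image[of t] by (metis image_comp)
    next
      assume pre: "pre_injective ?X \<tau>"
      have "x = y \<or> infinite {n. x n \<noteq> y n}"
        if xy: "x \<in> ?X" "y \<in> ?X" "(\<tau> \<circ> shift_pow t) x = (\<tau> \<circ> shift_pow t) y" for x y
      proof -
        have or: "shift_pow t x = shift_pow t y \<or> infinite {n. shift_pow t x n \<noteq> shift_pow t y n}"
          using pre xy shX unfolding pre_injective_def by simp
        \<comment> \<open>The shift only translates the set of differences, so its infinitude
          carries back to \<open>x\<close> and \<open>y\<close>.\<close>
        have sub: "{n. shift_pow t x n \<noteq> shift_pow t y n} \<subseteq> (\<lambda>n. n - t) ` {n. x n \<noteq> y n}"
        proof
          fix n assume "n \<in> {n. shift_pow t x n \<noteq> shift_pow t y n}"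
          then show "n \<in> (\<lambda>n. n - t) ` {n. x n \<noteq> y n}"
            by (intro image_eqI[of _ _ "n + t"]) (simp_all add: shift_pow_apply)
        qed
        from or show ?thesis
        proof
          assume "infinite {n. shift_pow t x n \<noteq> shift_pow t y n}"
          then have "infinite {n. x n \<noteq> y n}" using finite_subset[OF sub] by blast
          then show ?thesis ..
        qed (use inj in blast)
      qed
      then show ?thesis unfolding pre_injective_def by blast
    qed
    then have id: "(\<tau> \<circ> shift_pow t) x = x" if "x \<in> ?X" for x
      using t by (intro decreasing_automaton_eq_id[OF assms
            cellular_automaton_compose_shift[OF shX \<tau>] _ _ that]) auto
    have "\<tau> x = shift_pow (- t) x" if "x \<in> ?X" for x
      using id[OF shX[OF that, of "- t"]] shift_pow_uminus[of "- t" x] by simp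
    then show ?thesis by blast
  qed
  have "\<tau> ` ?X = ?X \<longleftrightarrow> pre_injective ?X \<tau>" if \<tau>: "cellular_automaton ?X \<tau>" for \<tau>
  proof
    assume "\<tau> ` ?X = ?X"
    then obtain t where "\<forall>x\<in>?X. \<tau> x = shift_pow t x" using shift[OF \<tau>] by blast
    then show "pre_injective ?X \<tau>" by (auto simp: pre_injective_def dest: inj)
  next
    assume "pre_injective ?X \<tau>"
    then obtain t where "\<forall>x\<in>?X. \<tau> x = shift_pow t x" using shift[OF \<tau>] by blast
    then have "\<tau> ` ?X = shift_pow t ` ?X" by (intro image_cong) auto
    then show "\<tau> ` ?X = ?X" by (simp only: image)
  qed
  moreover have "\<exists>t l \<phi>. given_by_code ?X (\<tau> \<circ> shift_pow t) l \<phi> \<and> monotone_code ?X l \<phi>"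
    if \<tau>: "cellular_automaton ?X \<tau>" for \<tau>
  proof -
    obtain t where t: "\<forall>x\<in>?X. \<forall>n. (\<tau> \<circ> shift_pow t) x n \<longrightarrow> x n" using decr[OF \<tau>] by blast
    obtain l \<phi> where \<phi>: "given_by_code ?X (\<tau> \<circ> shift_pow t) l \<phi>"
      using given_by_code_exists[OF cl shX cellular_automaton_compose_shift[OF shX \<tau>]] by blast
    \<comment> \<open>Every block considered occurs in some \<open>x\<close>, where its image and
      its central symbol are values of the decreasing automaton and of \<open>x\<close> at the same
      place.\<close>
    have "\<phi> w \<le> w 0" if w: "w \<in> blocks ?X l" for w
    proof -
      obtain x n where x: "x \<in> ?X" "w = window l x n" using w by (auto simp: blocks_def)
      then have "\<phi> w = (\<tau> \<circ> shift_pow t) x n" using \<phi> by (simp add: given_by_code_def)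
      moreover have "w 0 = x n" by (simp add: x(2) window_def)
      moreover have "(\<tau> \<circ> shift_pow t) x n \<longrightarrow> x n" using t x(1) by blast
      ultimately show ?thesis by (simp only: le_bool_def)
    qed
    with \<phi> show ?thesis unfolding monotone_code_def by blast
  qed
  ultimately show ?thesis using shift by blast
qed

end
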